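(* Let $x\in\mathbb{R}^n$ be strictly feasible, i.e. $f_i(x)<0$ for all $i\in\{1,\dots,m\}$. Let $\widehat{\nabla f}_0(x),\dots,\widehat{\nabla f}_m(x)\in\mathbb{R}^n$ be gradient estimates at $x$ satisfying $\|\nabla f_i(x)-\widehat{\nabla f}_i(x)\|\le\epsilon_i$ for all $i\in\{0,\dots,m\}$, and let $u(x)$ be an optimal solution of the robust subproblem $$\min_{u\in\mathbb{R}^n}\ \tfrac12\|u\|^2+\widehat{\nabla f}_0(x)^\top u+\epsilon_0\|u\|\quad\text{s.t.}\quad \widehat{\nabla f}_i(x)^\top u+\epsilon_i\|u\|+\alpha f_i(x)+w_i\|u\|^2\le 0,\quad i\in\{1,\dots,m\}.$$ If $u(x)=0$, then $x$ is an $\varepsilon$-KKT point of the problem $\min_x\{f_0(x): f_i(x)\le 0,\ i\in\{1,\dots,m\}\}$ with $\varepsilon=2\epsilon_0$.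
   Context: $\|\cdot\|$ is the Euclidean norm. The underlying problem is $f^\star=\min_x\{f_0(x)\ :\ f_i(x)\le 0,\ i\in\{1,\dots,m\}\}$, where $f_0,\dots,f_m:\mathbb{R}^n\to\mathbb{R}$; the value $f^\star>-\infty$ is attained at some feasible point. The feasible set is $\mathcal F=\{x: f_i(x)\le 0,\ i\in\{1,\dots,m\}\}$. The constants $\epsilon_0,\dots,\epsilon_m>0$, $\alpha>0$, $w_1,\dots,w_m>0$ are fixed. Standing assumptions. (Smoothness) Each $f_i$, $i\in\{0,\dots,m\}$, is continuously differentiable with $L_i$-Lipschitz gradient on $\mathbb{R}^n$. (MFCQ) For every $x\in\mathcal F$ there is $d\in\mathbb{R}^n$ with $\nabla f_i(x)^\top d<0$ for all $i\in\{1,\dots,m\}$ with $f_i(x)=0$. Definition. A point $x\in\mathcal F$ is an $\varepsilon$-KKT point if there exists $\lambda\in\mathbb{R}^m$ with $\lambda_i\ge 0$ for all $i$ such that $\big\|\nabla f_0(x)+\sum_{i=1}^m\lambda_i\nabla f_i(x)\big\|\le\varepsilon$ and, for all $i\in\{1,\dots,m\}$, $f_i(x)\le 0$ and $\lambda_i f_i(x)\ge-\varepsilon$. *)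

theory Defs
  imports "HOL-Analysis.Analysis"
begin

definition gradient :: "('a::euclidean_space \<Rightarrow> real) \<Rightarrow> 'a \<Rightarrow> 'a" where
  "gradient f x = (THE g. GDERIV f x :> g)"

text \<open>The description is proper: gradients are unique, and they exist at every point of
  differentiability.\<close>

lemma gradient_eqI:
  fixes f :: "'a::euclidean_space \<Rightarrow> real"
  assumes "GDERIV f x :> g"
  shows "gradient f x = g"
  unfolding gradient_def
proof (rule the_equality, rule assms)
  fix g' assume "GDERIV f x :> g'"
  then have "(\<lambda>h. inner h g') = (\<lambda>h. inner h g)"
    using assms has_derivative_unique unfolding gderiv_def by blast
  then have "inner h g' = inner h g" for h
    by metis
  then show "g' = g"
    by (metis vector_eq_ldot)
qed

lemma GDERIV_gradient:
  fixes f :: "'a::euclidean_space \<Rightarrow> real"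
  assumes "f differentiable (at x)"
  shows "GDERIV f x :> gradient f x"
proof -
  obtain f' where f': "(f has_derivative f') (at x)"
    using assms unfolding differentiable_def by blast
  then have "linear f'"
    by (rule has_derivative_linear)
  then have "f' = (\<lambda>h. inner h (adjoint f' 1))"
    using adjoint_works[of f'] by fastforce
  then have "GDERIV f x :> adjoint f' 1"
    using f' unfolding gderiv_def by simp
  then show ?thesis
    using gradient_eqI by metis
qed

definition lipschitz_smooth :: "real \<Rightarrow> ('a::euclidean_space \<Rightarrow> real) \<Rightarrow> bool" where
  "lipschitz_smooth L f \<longleftrightarrow>
     (\<forall>x. f differentiable (at x)) \<and> continuous_on UNIV (gradient f) \<and>
     L-lipschitz_on UNIV (gradient f)"

text \<open>A problem with \<open>m\<close> constraints is given by one family \<open>f\<close>: \<open>f 0\<close> is the objective and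
  \<open>f 1, \<dots>, f m\<close> are the constraint functions; \<open>f i\<close> is irrelevant for \<open>i > m\<close>.\<close>

definition feasible_set :: "nat \<Rightarrow> (nat \<Rightarrow> 'a \<Rightarrow> real) \<Rightarrow> 'a set" where
  "feasible_set m f = {x. \<forall>i\<in>{1..m}. f i x \<le> 0}"

definition MFCQ :: "nat \<Rightarrow> (nat \<Rightarrow> 'a::euclidean_space \<Rightarrow> real) \<Rightarrow> bool" where
  "MFCQ m f \<longleftrightarrow>
     (\<forall>x\<in>feasible_set m f. \<exists>d. \<forall>i\<in>{1..m}. f i x = 0 \<longrightarrow> inner (gradient (f i) x) d < 0)"

definition eps_KKT_point ::
  "nat \<Rightarrow> (nat \<Rightarrow> 'a::euclidean_space \<Rightarrow> real) \<Rightarrow> real \<Rightarrow> 'a \<Rightarrow> bool" where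
  "eps_KKT_point m f \<epsilon> x \<longleftrightarrow>
     x \<in> feasible_set m f \<and>
     (\<exists>l :: nat \<Rightarrow> real.
        (\<forall>i\<in>{1..m}. l i \<ge> 0) \<and>
        norm (gradient (f 0) x + (\<Sum>i\<in>{1..m}. l i *\<^sub>R gradient (f i) x)) \<le> \<epsilon> \<and>
        (\<forall>i\<in>{1..m}. f i x \<le> 0 \<and> l i * f i x \<ge> - \<epsilon>))"

text \<open>The robust subproblem at \<open>x\<close>, where \<open>g i\<close> is the estimate of the gradient of \<open>f i\<close> at \<open>x\<close>
  and \<open>eps i\<close> the bound on its error.\<close>

definition robust_objective ::
  "(nat \<Rightarrow> 'a::euclidean_space) \<Rightarrow> (nat \<Rightarrow> real) \<Rightarrow> 'a \<Rightarrow> real" where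
  "robust_objective g eps u = 1 / 2 * (norm u)\<^sup>2 + inner (g 0) u + eps 0 * norm u"

definition robust_feasible ::
  "nat \<Rightarrow> (nat \<Rightarrow> 'a::euclidean_space \<Rightarrow> real) \<Rightarrow> 'a \<Rightarrow> (nat \<Rightarrow> 'a) \<Rightarrow> (nat \<Rightarrow> real) \<Rightarrow>
     real \<Rightarrow> (nat \<Rightarrow> real) \<Rightarrow> 'a \<Rightarrow> bool" where
  "robust_feasible m f x g eps \<alpha> w u \<longleftrightarrow>
     (\<forall>i\<in>{1..m}. inner (g i) u + eps i * norm u + \<alpha> * f i x + w i * (norm u)\<^sup>2 \<le> 0)"

end

theory Submission
  imports Defs
begin

text \<open>Strict feasibility makes every small step feasible for the robust subproblem, so if \<open>0\<close> is
  optimal there, then it is a local minimizer of the unconstrained robust objective. Looking along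
  the ray \<open>- t *\<^sub>R g 0\<close> this forces \<open>norm (g 0) \<le> eps 0\<close>, hence the true objective gradient has norm at
  most \<open>2 * eps 0\<close> and the KKT conditions hold with all multipliers equal to zero.\<close>

text \<open>At \<open>v = 0\<close> each constraint expression equals
  \<open>\<alpha> * f i x < 0\<close>. Each one is continuous in \<open>v\<close>, and there are
  finitely many, so a single neighbourhood of \<open>0\<close> serves for all of them.\<close>

lemma eventually_robust_feasible:
  assumes "\<alpha> > 0" and "\<And>i. i \<in> {1..m} \<Longrightarrow> f i x < 0"
  shows "\<forall>\<^sub>F v in nhds 0. robust_feasible m f x g eps \<alpha> w v"
  unfolding robust_feasible_def
proof (intro eventually_ball_finite ballI finite_atLeastAtMost)
  fix i assume "i \<in> {1..m}"
  then have neg: "\<alpha> * f i x < 0"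
    using assms by (simp add: mult_pos_neg)
  have "((\<lambda>v. inner (g i) v + eps i * norm v + \<alpha> * f i x + w i * (norm v)\<^sup>2) \<longlongrightarrow>
      inner (g i) 0 + eps i * norm (0::'a) + \<alpha> * f i x + w i * (norm (0::'a))\<^sup>2) (nhds 0)"
    by (intro tendsto_intros filterlim_ident)
  then have "\<forall>\<^sub>F v in nhds 0.
      inner (g i) v + eps i * norm v + \<alpha> * f i x + w i * (norm v)\<^sup>2 < 0"
    using neg by (intro order_tendstoD(2)) auto
  then show "\<forall>\<^sub>F v in nhds 0.
      inner (g i) v + eps i * norm v + \<alpha> * f i x + w i * (norm v)\<^sup>2 \<le> 0"
    by (rule eventually_mono) simp
qed

text \<open>Near \<open>0\<close> the quadratic term is negligible, so a descent slope
  \<open>- norm (g 0) + eps 0 < 0\<close> along \<open>- g 0\<close> would make the objective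
  negative.\<close>

lemma norm_le_if_robust_objective_locally_nonneg:
  assumes "\<forall>\<^sub>F v in nhds 0. robust_objective g eps v \<ge> 0" and "eps 0 \<ge> 0"
  shows "norm (g 0) \<le> eps 0"
\<comment> \<open>The factor \<open>t * norm (g 0)\<close> is cancelled below, so it has to be
  positive.\<close>
proof (cases "g 0 = 0")
  case True
  then show ?thesis using assms(2) by simp
next
  case False
  let ?n = "norm (g 0)"
  have n: "?n > 0" using False by simp
  have "((\<lambda>t. - t *\<^sub>R g 0) \<longlongrightarrow> - 0 *\<^sub>R g 0) (at_right 0)"
    by (intro tendsto_intros)
  then have "filterlim (\<lambda>t. - t *\<^sub>R g 0) (nhds 0) (at_right 0)"
    by simp
  then have "\<forall>\<^sub>F t in at_right 0. robust_objective g eps (- t *\<^sub>R g 0) \<ge> 0"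
    using assms(1) by (rule eventually_compose_filterlim[rotated])
  moreover have "\<forall>\<^sub>F t in at_right (0::real). 0 < t"
    by (rule eventually_at_right_less)
  ultimately have "\<forall>\<^sub>F t in at_right 0. 0 \<le> t / 2 * ?n - ?n + eps 0"
  proof eventually_elim
    case (elim t)
    \<comment> \<open>This product is the objective at \<open>- t *\<^sub>R g 0\<close>, factored
      using \<open>t > 0\<close>.\<close>
    then have "0 \<le> (t * ?n) * (t / 2 * ?n - ?n + eps 0)"
      by (simp add: robust_objective_def power2_eq_square algebra_simps
          flip: norm_eq_sqrt_inner power2_norm_eq_inner)
    moreover have "0 < t * ?n"
      using elim n by simp
    ultimately show ?case
      by (meson not_le mult_pos_neg)
  qed
  moreover have "((\<lambda>t. t / 2 * ?n - ?n + eps 0) \<longlongrightarrow> 0 / 2 * ?n - ?n + eps 0) (at_right 0)"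
    by (intro tendsto_intros) simp
  ultimately have "0 \<le> 0 / 2 * ?n - ?n + eps 0"
    by (intro tendsto_lowerbound) auto
  then show ?thesis by simp
qed

theorem theorem2:
  fixes f :: "nat \<Rightarrow> real ^ 'n \<Rightarrow> real"
    and m :: nat
    and L eps w :: "nat \<Rightarrow> real"
    and \<alpha> :: real
    and x u :: "real ^ 'n"
    and g :: "nat \<Rightarrow> real ^ 'n"
  assumes "\<exists>xs. is_arg_min (f 0) (\<lambda>y. y \<in> feasible_set m f) xs"
    and "\<And>i. i \<in> {0..m} \<Longrightarrow> eps i > 0"
    and "\<alpha> > 0"
    and "\<And>i. i \<in> {1..m} \<Longrightarrow> w i > 0"
    and "\<And>i. i \<in> {0..m} \<Longrightarrow> lipschitz_smooth (L i) (f i)"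
    and "MFCQ m f"
    and "\<And>i. i \<in> {1..m} \<Longrightarrow> f i x < 0"
    and "\<And>i. i \<in> {0..m} \<Longrightarrow> norm (gradient (f i) x - g i) \<le> eps i"
    and "is_arg_min (robust_objective g eps) (robust_feasible m f x g eps \<alpha> w) u"
    and "u = 0"
  shows "eps_KKT_point m f (2 * eps 0) x"
proof -
  have "\<forall>\<^sub>F v in nhds 0. robust_feasible m f x g eps \<alpha> w v"
    using assms(3,7) by (rule eventually_robust_feasible)
  then have "\<forall>\<^sub>F v in nhds 0. robust_objective g eps v \<ge> 0"
  proof eventually_elim
    case (elim v)
    \<comment> \<open>\<open>is_arg_min\<close> excludes strictly smaller values at feasible points;
      the value at \<open>0\<close> is \<open>0\<close>.\<close>
    then have "\<not> robust_objective g eps v < robust_objective g eps 0"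
      using assms(9,10) by (auto simp: is_arg_min_def)
    then show ?case
      by (simp add: robust_objective_def)
  qed
  then have "norm (g 0) \<le> eps 0"
    using assms(2)[of 0] by (intro norm_le_if_robust_objective_locally_nonneg) auto
  \<comment> \<open>One \<open>eps 0\<close> comes from the estimation error, the other from
    optimality.\<close>
  moreover have "norm (gradient (f 0) x) \<le> norm (gradient (f 0) x - g 0) + norm (g 0)"
    using norm_triangle_ineq[of "gradient (f 0) x - g 0" "g 0"] by simp
  ultimately have "norm (gradient (f 0) x) \<le> 2 * eps 0"
    using assms(8)[of 0] by simp
  \<comment> \<open>With zero multipliers, approximate complementarity reads
    \<open>0 \<ge> - (2 * eps 0)\<close>.\<close>
  then show ?thesis
    using assms(2)[of 0] assms(7)
    by (auto simp: eps_KKT_point_def feasible_set_def less_imp_le intro!: exI[of _ "\<lambda>_. 0"])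
qed

end
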